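(* Let $\Omega=\Omega_1\times\cdots\times\Omega_d\subseteq\mathbb{R}^d$, let $\vec p=(p_1,\dots,p_d)$ with $0<p_i\le\infty$ for all $i$ and $\min\{p_1,\dots,p_d\}<\infty$, and let $0<q\le\infty$. If $\mu(\Omega)<\infty$, then 1. $L_{\vec p}(\Omega)\not\hookrightarrow L_{\min\{p_1,\dots,p_d\},s}(\Omega)$ for all $0<s<\min\{p_1,\dots,p_d\}$; 2. $L_{\vec p,q}(\Omega)\not\hookrightarrow L_{\min\{p_1,\dots,p_d\},u}(\Omega)$ for all $0<u<q$.
   Context: Setting: $\Omega_1,\dots,\Omega_d\subseteq\mathbb{R}$ are Lebesgue measurable sets of positive measure, $\Omega=\prod_i\Omega_i$, and $\mu$ is Lebesgue measure on $\Omega$. $X_1\hookrightarrow X_2$ means $X_1\subseteq X_2$ with continuous inclusion, i.e. $\|f\|_{X_2}\le c\|f\|_{X_1}$ for some $c>0$ and all $f\in X_1$; $\not\hookrightarrow$ is its negation. Mixed Lebesgue space: $L_{\vec p}(\Omega)$ consists of the measurable $f:\Omega\to\mathbb{R}$ with finite quasi-norm $$\|f\|_{\vec p}=\left(\int_{\Omega_d}\cdots\left(\int_{\Omega_1}|f(x_1,\dots,x_d)|^{p_1}\,dx_1\right)^{p_2/p_1}\cdots\,dx_d\right)^{1/p_d},$$ i.e. one takes the $L_{p_1}$ quasi-norm in $x_1$, then the $L_{p_2}$ quasi-norm in $x_2$, etc., with the essential supremum in $x_j$ if $p_j=\infty$. Mixed Lorentz space: $L_{\vec p,q}(\Omega)$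 consists of the measurable $f$ with finite quasi-norm $$\|f\|_{L_{\vec p,q}}=\left(\int_0^\infty u^q\,\|\chi_{\{|f|>u\}}\|_{\vec p}^q\,\frac{du}{u}\right)^{1/q}\ (0<q<\infty),\qquad \|f\|_{L_{\vec p,\infty}}=\sup_{u>0}u\,\|\chi_{\{|f|>u\}}\|_{\vec p},$$ where $\chi_A$ denotes the characteristic function of $A$. Classical Lorentz space $L_{r,s}(\Omega)$ ($0<r<\infty$): quasi-norm $\|f\|_{L_{r,s}}=\left(\int_0^\infty(t^{1/r}f^*(t))^s\frac{dt}{t}\right)^{1/s}$ for $0<s<\infty$ and $\sup_{t>0}t^{1/r}f^*(t)$ for $s=\infty$, where $f^*(t)=\inf\{\sigma>0:\mu(\{|f|>\sigma\})\le t\}$. *)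

theory Defs
  imports "HOL-Probability.Essential_Supremum"
begin

text \<open>
  Exponents in \<open>(0, \<infinity>]\<close> are elements of \<^typ>\<open>ennreal\<close>, and quasi-norms take values in
  \<^typ>\<open>ennreal\<close>, with \<open>\<infinity>\<close> meaning that the function is not in the space.
  Spaces consist of functions rather than of classes of almost everywhere equal functions;
  none of the quasi-norms distinguishes two functions that agree almost everywhere.
\<close>

text \<open>Power with a real exponent; intended for positive exponents.\<close>

definition ennreal_powr :: "ennreal \<Rightarrow> real \<Rightarrow> ennreal" where
  "ennreal_powr x a = (if x = \<infinity> then \<infinity> else ennreal (enn2real x powr a))"

definition Lp_norm :: "'a measure \<Rightarrow> ennreal \<Rightarrow> ('a \<Rightarrow> ennreal) \<Rightarrow> ennreal" where
  "Lp_norm M p F =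
     (if p = \<infinity> then esssup M F
      else ennreal_powr (\<integral>\<^sup>+x. ennreal_powr (F x) (enn2real p) \<partial>M) (1 / enn2real p))"

definition box_product :: "('n \<Rightarrow> real set) \<Rightarrow> (real ^ 'n::finite) set" where
  "box_product \<Omega> = {x. \<forall>i. x $ i \<in> \<Omega> i}"

text \<open>
  Coordinates are ordered by the linear order of the index type, which represents \<open>1 < \<dots> < d\<close>.
  A partial norm in coordinate \<open>i\<close> is again regarded as a function on the whole of \<open>\<real>\<^sup>d\<close>,
  one that no longer depends on \<open>x\<^sub>i\<close>.
\<close>

definition partial_norm ::
  "('n \<Rightarrow> real set) \<Rightarrow> ('n \<Rightarrow> ennreal) \<Rightarrow> 'n \<Rightarrow> (real ^ 'n::finite \<Rightarrow> ennreal) \<Rightarrow> real ^ 'n \<Rightarrow> ennreal"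
  where
  "partial_norm \<Omega> p i F =
     (\<lambda>x. Lp_norm (lebesgue_on (\<Omega> i)) (p i) (\<lambda>t. F (\<chi> j. if j = i then t else x $ j)))"

text \<open>
  The partial norms are applied in increasing order of the coordinates, the smallest one
  innermost. After all coordinates have been used the result is a constant function, so
  evaluating it at \<open>0\<close> is an arbitrary choice. On a null set of sections the integrand may fail
  to be measurable; the value of the partial norm there is irrelevant.
\<close>

definition mixed_norm ::
  "('n \<Rightarrow> real set) \<Rightarrow> ('n \<Rightarrow> ennreal) \<Rightarrow> (real ^ 'n::{finite,linorder} \<Rightarrow> real) \<Rightarrow> ennreal" where
  "mixed_norm \<Omega> p f =
     fold (partial_norm \<Omega> p) (sorted_list_of_set (UNIV :: 'n set)) (\<lambda>x. ennreal \<bar>f x\<bar>) 0"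

text \<open>The \<open>L\<^sub>q\<close> quasi-norm on \<open>(0, \<infinity>)\<close> with respect to the measure \<open>dt / t\<close>, for \<open>q < \<infinity>\<close>,
  and the supremum (not the essential supremum) for \<open>q = \<infinity>\<close>.\<close>

definition mult_norm :: "ennreal \<Rightarrow> (real \<Rightarrow> ennreal) \<Rightarrow> ennreal" where
  "mult_norm q g =
     (if q = \<infinity> then (SUP t\<in>{0<..}. g t)
      else ennreal_powr
        (\<integral>\<^sup>+t\<in>{0<..}. (ennreal_powr (g t) (enn2real q) / ennreal t) \<partial>lborel) (1 / enn2real q))"

definition mixed_Lorentz_norm ::
  "('n \<Rightarrow> real set) \<Rightarrow> ('n \<Rightarrow> ennreal) \<Rightarrow> ennreal \<Rightarrow>
    (real ^ 'n::{finite,linorder} \<Rightarrow> real) \<Rightarrow> ennreal" where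
  "mixed_Lorentz_norm \<Omega> p q f =
     mult_norm q (\<lambda>u. ennreal u * mixed_norm \<Omega> p (indicator {x. \<bar>f x\<bar> > u}))"

definition decr_rearrangement :: "'a measure \<Rightarrow> ('a \<Rightarrow> real) \<Rightarrow> real \<Rightarrow> ennreal" where
  "decr_rearrangement M f t =
     Inf (ennreal ` {\<sigma>. 0 < \<sigma> \<and> emeasure M {x \<in> space M. \<bar>f x\<bar> > \<sigma>} \<le> ennreal t})"

text \<open>Only meaningful for \<open>0 < r < \<infinity>\<close>.\<close>

definition Lorentz_norm :: "'a measure \<Rightarrow> ennreal \<Rightarrow> ennreal \<Rightarrow> ('a \<Rightarrow> real) \<Rightarrow> ennreal" where
  "Lorentz_norm M r s f =
     mult_norm s (\<lambda>t. ennreal (t powr (1 / enn2real r)) * decr_rearrangement M f t)"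

definition function_space :: "'a measure \<Rightarrow> (('a \<Rightarrow> real) \<Rightarrow> ennreal) \<Rightarrow> ('a \<Rightarrow> real) set" where
  "function_space M N = {f \<in> borel_measurable M. N f < \<infinity>}"

text \<open>Continuous inclusion of the function spaces over \<open>M\<close> given by the quasi-norms
  \<open>N\<^sub>1\<close> and \<open>N\<^sub>2\<close>.\<close>

definition cont_embedded ::
  "'a measure \<Rightarrow> (('a \<Rightarrow> real) \<Rightarrow> ennreal) \<Rightarrow> (('a \<Rightarrow> real) \<Rightarrow> ennreal) \<Rightarrow> bool" where
  "cont_embedded M N\<^sub>1 N\<^sub>2 \<longleftrightarrow>
     function_space M N\<^sub>1 \<subseteq> function_space M N\<^sub>2 \<and>
     (\<exists>c>0. \<forall>f\<in>function_space M N\<^sub>1. N\<^sub>2 f \<le> ennreal c * N\<^sub>1 f)"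

end

theory Submission
  imports Defs "HOL-Probability.Distribution_Functions"
begin

text \<open>
  Let \<open>p\<^sub>k = r\<close> be the smallest exponent. For a function of \<open>x\<^sub>k\<close> alone, the partial norms in the other
  coordinates only contribute constant factors, so the mixed norms reduce to the norms of \<open>L\<^sub>r\<close> and
  \<open>L\<^bsub>r,q\<^esub>\<close> on \<open>\<Omega>\<^sub>k\<close>. With \<open>m(t)\<close> the measure of \<open>\<Omega>\<^sub>k \<inter> (-\<infinity>, t]\<close>, which is uniformly distributed on
  \<open>(0, T)\<close> for \<open>T = |\<Omega>\<^sub>k|\<close>, the truncated powers \<open>max (m(x\<^sub>k)) (T e\<^bsup>-L\<^esup>)\<^bsup>-1/r\<^esup>\<close> have norm of order \<open>L\<^bsup>1/r\<^esup>\<close>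
  in \<open>L\<^sub>p\<close>, \<open>L\<^bsup>1/q\<^esup>\<close> in \<open>L\<^bsub>p,q\<^esub>\<close> and \<open>L\<^bsup>1/s\<^esup>\<close> in \<open>L\<^bsub>r,s\<^esub>\<close>. Letting \<open>L \<longrightarrow> \<infinity>\<close> excludes every embedding
  constant if \<open>s < r\<close>, respectively \<open>s < q\<close>.
\<close>

section \<open>Lebesgue measure of boxes\<close>

lemma coordinate_measurable [measurable]: "(\<lambda>x. x $ i) \<in> borel_measurable (borel :: (real ^ 'n::finite) measure)"
  by (intro borel_measurable_continuous_onI continuous_intros)

lemma box_product_borel [measurable]:
  fixes B :: "'n::finite \<Rightarrow> real set"
  assumes [measurable]: "\<And>i. B i \<in> sets borel"
  shows "box_product B \<in> sets borel"
proof -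
  have "box_product B = (\<Inter>i. {x \<in> space borel. x $ i \<in> B i})"
    by (auto simp: box_product_def)
  also have "\<dots> \<in> sets borel"
    by (intro sets.finite_INT) auto
  finally show ?thesis .
qed

lemma emeasure_lborel_box_product:
  fixes B :: "'n::finite \<Rightarrow> real set"
  assumes [measurable]: "\<And>i. B i \<in> sets borel"
  shows "emeasure lborel (box_product B) = (\<Prod>i\<in>UNIV. emeasure lborel (B i))"
proof -
  have Basis: "(Basis :: (real ^ 'n) set) = (\<lambda>i. axis i 1) ` UNIV"
    by (auto simp: Basis_vec_def)
  have inj: "inj (\<lambda>i::'n. axis i (1::real))"
    by (auto simp: inj_on_def axis_eq_axis)
  have "emeasure lborel (box_product B) = (\<integral>\<^sup>+x. indicator (box_product B) x \<partial>lborel)"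
    using box_product_borel[of B] by simp
  also have "(\<integral>\<^sup>+x. indicator (box_product B) x \<partial>lborel) =
      (\<integral>\<^sup>+(x :: real ^ 'n). ennreal (\<Prod>b\<in>Basis. indicator (B (axis_index b)) (x \<bullet> b)) \<partial>lborel)"
  proof (intro nn_integral_cong)
    fix x :: "real ^ 'n"
    have "(\<Prod>b\<in>(Basis :: (real ^ 'n) set). indicator (B (axis_index b)) (x \<bullet> b)) = (\<Prod>i\<in>UNIV. indicator (B i) (x $ i) :: real)"
      unfolding Basis by (subst prod.reindex[OF inj]) (simp add: axis_index_axis inner_axis)
    also have "\<dots> = indicator (box_product B) x"
      by (auto simp: box_product_def indicator_def)
    finally show "indicator (box_product B) x =
        ennreal (\<Prod>b\<in>Basis. indicator (B (axis_index b)) (x \<bullet> b))"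
      by (simp add: ennreal_indicator)
  qed
  also have "\<dots> = (\<Prod>b\<in>(Basis :: (real ^ 'n) set). \<integral>\<^sup>+t. ennreal (indicator (B (axis_index b)) t) \<partial>lborel)"
    using nn_integral_lborel_prod[of "\<lambda>b t. ennreal (indicator (B (axis_index b)) t)"]
    by (simp add: prod_ennreal)
  also have "\<dots> = (\<Prod>i\<in>UNIV. emeasure lborel (B i))"
    unfolding Basis by (subst prod.reindex[OF inj]) (simp add: axis_index_axis ennreal_indicator)
  finally show ?thesis .
qed

lemma AE_lborel_coordinate:
  fixes i :: "'n::finite"
  assumes "AE t in lborel. P (t::real)"
  shows "AE x in lborel. P ((x :: real ^ 'n) $ i)"
proof -
  obtain N where N: "N \<in> null_sets lborel" "{t. \<not> P t} \<subseteq> N"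
    using assms by (auto elim!: AE_E simp: null_sets_def)
  define B where "B = (\<lambda>j. if j = i then N else UNIV)"
  have "emeasure lborel (box_product B :: (real ^ 'n) set) = 0"
    using N by (subst emeasure_lborel_box_product) (auto simp: B_def null_sets_def)
  moreover have "box_product B = {x \<in> space borel. x $ i \<in> N}"
    by (auto simp: B_def box_product_def split: if_splits)
  moreover have "{x \<in> space borel. (x :: real ^ 'n) $ i \<in> N} \<in> sets lborel"
    using N by (auto simp: null_sets_def)
  ultimately have "{x \<in> space borel. (x :: real ^ 'n) $ i \<in> N} \<in> null_sets lborel"
    by auto
  then show ?thesis
    using N(2) by (rule_tac AE_I') auto
qed

lemma
  fixes \<Omega> :: "'n::finite \<Rightarrow> real set"
  assumes \<Omega>: "\<And>i. \<Omega> i \<in> sets lebesgue"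
  shows box_product_lebesgue [measurable]: "box_product \<Omega> \<in> sets lebesgue" (is ?sets)
    and emeasure_box_product:
      "emeasure lebesgue (box_product \<Omega>) = (\<Prod>i\<in>UNIV. emeasure lebesgue (\<Omega> i))" (is ?eq)
proof -
  define B where "B i = main_part lborel (\<Omega> i)" for i
  have B: "B i \<in> sets borel" "emeasure lborel (B i) = emeasure lebesgue (\<Omega> i)" for i
    using main_part_sets[OF \<Omega>] \<Omega> by (auto simp: B_def)
  have "AE x in lborel. x $ i \<in> B i \<longleftrightarrow> x $ i \<in> \<Omega> i" for i
    using AE_lborel_coordinate[OF AE_in_main_part[OF \<Omega>]] by (auto simp: B_def)
  then have "AE x in lborel. \<forall>i\<in>UNIV. x $ i \<in> B i \<longleftrightarrow> x $ i \<in> \<Omega> i"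
    by (intro AE_finite_allI) auto
  then have ae: "AE x in lebesgue. x \<in> box_product B \<longleftrightarrow> x \<in> box_product \<Omega>"
    by (intro AE_completion) (auto simp: box_product_def elim: eventually_mono)
  have Bs: "box_product B \<in> sets lebesgue"
    using box_product_borel[of B] B(1) by simp
  show ?sets
    by (rule completion.in_sets_AE[OF _ Bs]) (use ae in \<open>auto elim: eventually_mono\<close>)
  then have "emeasure lebesgue (box_product \<Omega>) = emeasure lebesgue (box_product B)"
    using Bs ae by (intro emeasure_eq_AE) (auto elim: eventually_mono)
  then show ?eq
    using emeasure_lborel_box_product[of B] box_product_borel[of B] B by simp
qed

section \<open>Mixed norms of functions of one coordinate\<close>

lemma ennreal_powr_mult:
  assumes "0 < a"
  shows "ennreal_powr (x * y) a = ennreal_powr x a * ennreal_powr y a"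
proof (cases "x = \<infinity> \<or> y = \<infinity>")
  case True
  have "ennreal (enn2real z powr a) \<noteq> 0" if "z \<noteq> 0" "z \<noteq> \<infinity>" for z :: ennreal
    using that by (cases z) (auto simp: ennreal_eq_0_iff)
  with True assms show ?thesis
    by (auto simp: ennreal_powr_def ennreal_mult_top ennreal_top_mult)
next
  case False
  then have "x * y \<noteq> \<infinity>"
    by (auto simp: ennreal_mult_eq_top_iff)
  with False show ?thesis
    by (simp add: ennreal_powr_def enn2real_mult powr_mult ennreal_mult)
qed

lemma ennreal_powr_ennreal [simp]: "0 \<le> x \<Longrightarrow> ennreal_powr (ennreal x) a = ennreal (x powr a)"
  by (simp add: ennreal_powr_def)

lemma ennreal_powr_mono:
  assumes "x \<le> y" "0 < a"
  shows "ennreal_powr x a \<le> ennreal_powr y a"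
proof (cases "y = \<infinity>")
  case False
  then have "x < \<infinity>" "y < \<infinity>"
    using assms(1) by (auto simp: less_top[symmetric] top_unique)
  with assms show ?thesis
    by (auto simp: ennreal_powr_def intro!: ennreal_leI powr_mono2 enn2real_mono)
qed (simp add: ennreal_powr_def)

lemma ennreal_powr_powr: "0 < a \<Longrightarrow> ennreal_powr (ennreal_powr x a) b = ennreal_powr x (a * b)"
  by (simp add: ennreal_powr_def powr_powr)

lemma ennreal_powr_one [simp]: "ennreal_powr x 1 = x"
  by (cases x) (auto simp: ennreal_powr_def)

lemma one_ennreal_powr [simp]: "ennreal_powr 1 a = 1"
  by (simp add: ennreal_powr_def)

lemma enn2real_pos: "0 < p \<Longrightarrow> p \<noteq> \<infinity> \<Longrightarrow> 0 < enn2real p"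
  by (cases p) auto

lemma ennreal_powr_less_top: "x < top \<Longrightarrow> ennreal_powr x a < top"
  by (auto simp: ennreal_powr_def)

lemma Lp_norm_cmult:
  assumes "0 < p" "p \<noteq> \<infinity>" "H \<in> borel_measurable M"
  shows "Lp_norm M p (\<lambda>x. a * H x) = a * Lp_norm M p H"
proof -
  have [measurable]: "(\<lambda>x. ennreal_powr (H x) (enn2real p)) \<in> borel_measurable M"
    using assms(3) unfolding ennreal_powr_def by measurable
  show ?thesis
    using enn2real_pos[OF assms(1,2)] assms(2)
    by (simp add: Lp_norm_def ennreal_powr_mult ennreal_powr_powr nn_integral_cmult)
qed

lemma Lp_norm_const:
  assumes "0 < p" "emeasure M (space M) \<noteq> 0"
  shows "Lp_norm M p (\<lambda>x. a) = a * Lp_norm M p (\<lambda>x. 1)"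
  using assms Lp_norm_cmult[of p "\<lambda>x. 1" M a]
  by (cases "p = \<infinity>") (auto simp: Lp_norm_def esssup_const)

lemma Lp_norm_one_finite:
  assumes "0 < p" "emeasure M (space M) \<noteq> 0" "emeasure M (space M) < \<infinity>"
  shows "Lp_norm M p (\<lambda>x. 1) < \<infinity>"
  using assms by (cases "p = \<infinity>")
    (auto simp: Lp_norm_def esssup_const ennreal_powr_less_top)

lemma fold_partial_norm_const:
  fixes \<Omega> :: "'n::finite \<Rightarrow> real set"
  assumes "\<And>i. 0 < p i" "\<And>i. emeasure (lebesgue_on (\<Omega> i)) (space (lebesgue_on (\<Omega> i))) \<noteq> 0"
    and "k \<notin> set xs"
  shows "fold (partial_norm \<Omega> p) xs (\<lambda>x. a * H (x $ k)) =
    (\<lambda>x. a * (\<Prod>i\<leftarrow>xs. Lp_norm (lebesgue_on (\<Omega> i)) (p i) (\<lambda>_. 1)) * H (x $ k))"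
  using assms(3)
proof (induction xs arbitrary: a)
  case (Cons i xs)
  then have "k \<noteq> i" by auto
  then have "partial_norm \<Omega> p i (\<lambda>x. a * H (x $ k)) =
      (\<lambda>x. (a * Lp_norm (lebesgue_on (\<Omega> i)) (p i) (\<lambda>_. 1)) * H (x $ k))"
    unfolding partial_norm_def
    by (simp add: Lp_norm_const[OF assms(1,2), of _ _ "a * _"] mult_ac)
  then have "fold (partial_norm \<Omega> p) (i # xs) (\<lambda>x. a * H (x $ k)) =
      fold (partial_norm \<Omega> p) xs (\<lambda>x. (a * Lp_norm (lebesgue_on (\<Omega> i)) (p i) (\<lambda>_. 1)) * H (x $ k))"
    by simp
  also have "\<dots> = (\<lambda>x. (a * Lp_norm (lebesgue_on (\<Omega> i)) (p i) (\<lambda>_. 1)) *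
      (\<Prod>i\<leftarrow>xs. Lp_norm (lebesgue_on (\<Omega> i)) (p i) (\<lambda>_. 1)) * H (x $ k))"
    using Cons by (intro Cons.IH) auto
  finally show ?case
    by (simp add: mult.assoc)
qed simp

lemma mixed_norm_one_coordinate:
  fixes \<Omega> :: "'n::{finite,linorder} \<Rightarrow> real set"
  assumes "\<And>i. \<Omega> i \<in> sets lebesgue"
    and "\<And>i. 0 < emeasure lebesgue (\<Omega> i)" "\<And>i. emeasure lebesgue (\<Omega> i) < \<infinity>"
    and p: "\<And>i. 0 < p i" "p k \<noteq> \<infinity>"
  obtains C where "C < \<infinity>"
    and "\<And>h. h \<in> borel_measurable borel \<Longrightarrow>
      mixed_norm \<Omega> p (\<lambda>x. h (x $ k)) = C * Lp_norm (lebesgue_on (\<Omega> k)) (p k) (\<lambda>t. ennreal \<bar>h t\<bar>)"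
proof -
  define c where "c i = Lp_norm (lebesgue_on (\<Omega> i)) (p i) (\<lambda>_. 1)" for i
  have "emeasure (lebesgue_on (\<Omega> i)) (space (lebesgue_on (\<Omega> i))) = emeasure lebesgue (\<Omega> i)" for i
    using assms(1) by (subst emeasure_restrict_space) (auto simp: space_restrict_space)
  then have pos: "emeasure (lebesgue_on (\<Omega> i)) (space (lebesgue_on (\<Omega> i))) \<noteq> 0"
    and fin: "emeasure (lebesgue_on (\<Omega> i)) (space (lebesgue_on (\<Omega> i))) < \<infinity>" for i
    using assms(2)[of i] assms(3)[of i] by auto
  have c: "c i < \<infinity>" for i
    unfolding c_def using p(1) pos fin by (rule Lp_norm_one_finite)
  obtain xs ys where xs: "sorted_list_of_set (UNIV :: 'n set) = xs @ k # ys"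
    using split_list[of k "sorted_list_of_set (UNIV :: 'n set)"] by auto
  then have "k \<notin> set xs" "k \<notin> set ys"
    using distinct_sorted_list_of_set[of "UNIV :: 'n set"] by auto
  note fold = fold_partial_norm_const[of p \<Omega>, OF p(1) pos, folded c_def]
  define C where "C = (\<Prod>i\<leftarrow>xs. c i) * (\<Prod>i\<leftarrow>ys. c i)"
  have prod_fin: "(\<Prod>i\<leftarrow>zs. c i) < \<infinity>" for zs
    using c by (induction zs) (auto simp: ennreal_mult_less_top)
  show thesis
  proof
    show "C < \<infinity>"
      using prod_fin by (auto simp: C_def ennreal_mult_less_top)
    fix h :: "real \<Rightarrow> real" assume [measurable]: "h \<in> borel_measurable borel"
    let ?F = "\<lambda>x. ennreal \<bar>h (x $ k)\<bar>"
    let ?N = "Lp_norm (lebesgue_on (\<Omega> k)) (p k) (\<lambda>t. ennreal \<bar>h t\<bar>)"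
    have H: "(\<lambda>t. ennreal \<bar>h t\<bar>) \<in> borel_measurable (lebesgue_on (\<Omega> k))"
      by (intro measurable_restrict_space1 measurable_completion) measurable
    have "fold (partial_norm \<Omega> p) xs ?F = (\<lambda>x. (\<Prod>i\<leftarrow>xs. c i) * ?F x)"
      using fold[OF \<open>k \<notin> set xs\<close>, where a = 1 and H = "\<lambda>t. ennreal \<bar>h t\<bar>"] by simp
    moreover have "partial_norm \<Omega> p k (\<lambda>x. (\<Prod>i\<leftarrow>xs. c i) * ?F x) = (\<lambda>x. (\<Prod>i\<leftarrow>xs. c i) * ?N)"
      unfolding partial_norm_def by (simp add: Lp_norm_cmult[OF p H])
    moreover have "fold (partial_norm \<Omega> p) ys (\<lambda>x. (\<Prod>i\<leftarrow>xs. c i) * ?N) =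
        (\<lambda>x. (\<Prod>i\<leftarrow>xs. c i) * ?N * (\<Prod>i\<leftarrow>ys. c i))"
      using fold[OF \<open>k \<notin> set ys\<close>, where a = "(\<Prod>i\<leftarrow>xs. c i) * ?N" and H = "\<lambda>_. 1"] by simp
    ultimately show "mixed_norm \<Omega> p (\<lambda>x. h (x $ k)) = C * ?N"
      by (simp add: mixed_norm_def xs C_def mult_ac)
  qed
qed

section \<open>Truncated powers of a distribution function\<close>

lemma less_powr_minus_inverse_iff:
  fixes x u r :: real
  assumes "0 < x" "0 < u" "0 < r"
  shows "u < x powr (- 1 / r) \<longleftrightarrow> x < u powr (- r)"
proof -
  have "u < x powr (- 1 / r) \<longleftrightarrow> ln u < - 1 / r * ln x"
    using assms by (subst ln_less_cancel_iff[symmetric]) (auto simp: ln_powr)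
  also have "\<dots> \<longleftrightarrow> ln x < - r * ln u"
    using assms by (auto simp: field_simps)
  also have "\<dots> \<longleftrightarrow> x < u powr (- r)"
    using assms by (subst (2) ln_less_cancel_iff[symmetric]) (auto simp: ln_powr)
  finally show ?thesis .
qed

locale atomless_borel_measure = finite_borel_measure +
  assumes atomless: "measure M {x} = 0"
    and total_pos: "0 < measure M (space M)"
begin

lemma cdf_surj:
  assumes "0 < t" "t < measure M (space M)"
  obtains x where "cdf M x = t"
proof -
  obtain a where a: "cdf M a < t"
    using order_tendstoD(2)[OF cdf_lim_at_bot assms(1)] by (auto simp: eventually_at_bot_linorder)
  obtain b where b: "t < cdf M b"
    using order_tendstoD(1)[OF cdf_lim_at_top assms(2)] by (auto simp: eventually_at_top_linorder)
  have "a \<le> b"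
    using a b cdf_nondecreasing[of b a] by linarith
  then show thesis
    using IVT'[of "cdf M" a t b] a b that isCont_cdf atomless
    by (fastforce intro: continuous_at_imp_continuous_on)
qed

lemma borel_measurable_cdf [measurable]: "cdf M \<in> borel_measurable borel"
  by (intro borel_measurable_mono monoI cdf_nondecreasing)

lemma measure_cdf_le:
  assumes "0 \<le> t"
  shows "measure M {x. cdf M x \<le> t} \<le> t"
proof (cases "t < measure M (space M)")
  case True
  show ?thesis
  proof (rule dense_ge_bounded[OF True])
    fix t' assume t': "t < t'" "t' < measure M (space M)"
    then obtain y where y: "cdf M y = t'"
      using assms cdf_surj[of t'] by auto
    have "{x. cdf M x \<le> t} \<subseteq> {..y}"
      using y t' cdf_nondecreasing[of y] by (auto simp: not_le[symmetric]) (smt (verit))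
    then have "measure M {x. cdf M x \<le> t} \<le> measure M {..y}"
      by (rule finite_measure_mono) auto
    with y show "measure M {x. cdf M x \<le> t} \<le> t'"
      by (simp add: cdf_def)
  qed
qed (use bounded_measure[of "{x. cdf M x \<le> t}"] in linarith)

lemma measure_cdf_le_ge:
  assumes "0 < t" "t < measure M (space M)"
  shows "t \<le> measure M {x. cdf M x \<le> t}"
proof -
  obtain y where y: "cdf M y = t"
    using assms cdf_surj by auto
  have "{..y} \<subseteq> {x. cdf M x \<le> t}"
    using y cdf_nondecreasing by auto
  moreover have "{x. cdf M x \<le> t} \<in> sets M"
    by (intro sets_M) measurable
  ultimately have "measure M {..y} \<le> measure M {x. cdf M x \<le> t}"
    by (rule finite_measure_mono)
  with y show ?thesis
    by (simp add: cdf_def)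
qed

definition trunc_cdf :: "real \<Rightarrow> real \<Rightarrow> real" where
  "trunc_cdf L x = max (cdf M x) (measure M (space M) * exp (- L))"

text \<open>For \<open>M\<close> the Lebesgue measure on \<open>(0, T)\<close> this is \<open>x\<^bsup>-1/r\<^esup>\<close>, truncated at \<open>T e\<^bsup>-L\<^esup>\<close>.\<close>

definition profile :: "real \<Rightarrow> real \<Rightarrow> real \<Rightarrow> real" where
  "profile r L x = trunc_cdf L x powr (- 1 / r)"

lemma trunc_cdf_pos [simp]: "0 < trunc_cdf L x"
  using total_pos by (simp add: trunc_cdf_def less_max_iff_disj)

lemma profile_nonneg [simp]: "0 \<le> profile r L x"
  by (simp add: profile_def)

lemma borel_measurable_profile [measurable]: "profile r L \<in> borel_measurable borel"
  unfolding profile_def[abs_def] trunc_cdf_def by measurable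

lemma less_profile_iff:
  "0 < r \<Longrightarrow> 0 < u \<Longrightarrow> u < profile r L x \<longleftrightarrow> trunc_cdf L x < u powr (- r)"
  using less_powr_minus_inverse_iff[OF trunc_cdf_pos] by (simp add: profile_def)

lemma emeasure_profile_le:
  assumes "0 < r" "0 < u"
  shows "emeasure M {x. u < profile r L x} \<le> ennreal (u powr (- r))"
proof -
  have "{x. u < profile r L x} \<subseteq> {x. cdf M x \<le> u powr (- r)}"
    using assms by (auto simp: less_profile_iff trunc_cdf_def)
  moreover have "{x. cdf M x \<le> u powr (- r)} \<in> sets M"
    by (intro sets_M) measurable
  ultimately have "emeasure M {x. u < profile r L x} \<le> emeasure M {x. cdf M x \<le> u powr (- r)}"
    by (rule emeasure_mono)
  also have "\<dots> \<le> ennreal (u powr (- r))"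
    using measure_cdf_le[of "u powr (- r)"] by (auto simp: emeasure_eq_measure)
  finally show ?thesis .
qed

lemma emeasure_profile_eq_0:
  assumes "0 < r" "(measure M (space M) * exp (- L)) powr (- 1 / r) \<le> u"
  shows "emeasure M {x. u < profile r L x} = 0"
proof -
  have pos: "0 < measure M (space M) * exp (- L)"
    using total_pos by simp
  then have "0 < (measure M (space M) * exp (- L)) powr (- 1 / r)"
    by (metis less_irrefl powr_gt_zero)
  then have "0 < u"
    using assms(2) by (rule less_le_trans)
  have "u powr (- r) \<le> measure M (space M) * exp (- L)"
    using assms less_powr_minus_inverse_iff[OF pos \<open>0 < u\<close> \<open>0 < r\<close>] by auto
  then have "{x. u < profile r L x} = {}"
    using assms \<open>0 < u\<close> by (auto simp: less_profile_iff trunc_cdf_def)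
  then show ?thesis by simp
qed

lemma emeasure_profile_greater:
  assumes "0 < r" "0 < \<sigma>" "\<sigma> < t powr (- 1 / r)"
    and t: "measure M (space M) * exp (- L) \<le> t" "t < measure M (space M)"
  shows "ennreal t < emeasure M {x. \<sigma> < profile r L x}"
proof -
  have "0 < t"
    using total_pos t(1) by (auto intro: less_le_trans[rotated])
  then have "t < \<sigma> powr (- r)"
    using assms less_powr_minus_inverse_iff by auto
  then obtain t' where t': "t < t'" "t' < min (measure M (space M)) (\<sigma> powr (- r))"
    using dense[of t "min (measure M (space M)) (\<sigma> powr (- r))"] t(2) by auto
  have "t < t'" by fact
  also have "t' \<le> measure M {x. cdf M x \<le> t'}"
    using t' \<open>0 < t\<close> by (intro measure_cdf_le_ge) auto
  also have "\<dots> \<le> measure M {x. \<sigma> < profile r L x}"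
  proof (rule finite_measure_mono)
    show "{x. cdf M x \<le> t'} \<subseteq> {x. \<sigma> < profile r L x}"
      using t' t assms(1,2) by (auto simp: less_profile_iff trunc_cdf_def)
    show "{x. \<sigma> < profile r L x} \<in> sets M"
      by (intro sets_M) measurable
  qed
  finally show ?thesis
    using \<open>0 < t\<close> by (auto simp: emeasure_eq_measure intro: ennreal_lessI)
qed

text \<open>Fubini applied to \<open>1 / y = 1 / T + \<integral>\<^sub>y\<^sup>T t\<^sup>-\<^sup>2 dt\<close> with \<open>y = trunc_cdf L x\<close>.\<close>

lemma nn_integral_inverse_trunc_cdf:
  assumes "0 \<le> L"
  shows "(\<integral>\<^sup>+x. ennreal (1 / trunc_cdf L x) \<partial>M) \<le> ennreal (1 + L)"
proof -
  define T where "T = measure M (space M)"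
  have T: "0 < T" "0 < T * exp (- L)" "T * exp (- L) \<le> T"
    using total_pos assms by (auto simp: T_def)
  have le_T: "trunc_cdf L x \<le> T" for x
    using cdf_bounded[of x] T by (auto simp: trunc_cdf_def T_def)
  have sets_eq [measurable_cong]: "sets M = sets borel" by (rule M_is_borel)
  interpret pair_sigma_finite M "lborel :: real measure" ..
  let ?k = "\<lambda>x t. ennreal (1 / t ^ 2) * indicator {T * exp (- L)..T} t * indicator {x. cdf M x \<le> t} x"
  have eq: "ennreal (1 / trunc_cdf L x) = ennreal (1 / T) + (\<integral>\<^sup>+t. ?k x t \<partial>lborel)" for x
  proof -
    have "(\<integral>\<^sup>+t. ?k x t \<partial>lborel) = (\<integral>\<^sup>+t. ennreal (1 / t ^ 2) * indicator {trunc_cdf L x..T} t \<partial>lborel)"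
      by (intro nn_integral_cong) (auto simp: trunc_cdf_def T_def indicator_def)
    also have "\<dots> = ennreal (- 1 / T - (- 1 / trunc_cdf L x))"
    proof (rule nn_integral_FTC_Icc)
      fix t assume "t \<in> {trunc_cdf L x..T}"
      then have "t \<noteq> 0"
        using less_le_trans[OF trunc_cdf_pos] by fastforce
      then show "((\<lambda>t. - 1 / t) has_real_derivative 1 / t ^ 2) (at t)"
        by (auto intro!: derivative_eq_intros simp: power2_eq_square)
    qed (use le_T in auto)
    finally show ?thesis
      using T le_T[of x] by (simp flip: ennreal_plus add: frac_le)
  qed
  have "(\<integral>\<^sup>+x. ennreal (1 / trunc_cdf L x) \<partial>M) = ennreal (1 / T) * emeasure M (space M) + (\<integral>\<^sup>+x. \<integral>\<^sup>+t. ?k x t \<partial>lborel \<partial>M)"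
    unfolding eq by (subst nn_integral_add) auto
  also have "(\<integral>\<^sup>+x. \<integral>\<^sup>+t. ?k x t \<partial>lborel \<partial>M) = (\<integral>\<^sup>+t. \<integral>\<^sup>+x. ?k x t \<partial>M \<partial>lborel)"
    by (rule Fubini'[symmetric]) measurable
  also have "\<dots> \<le> (\<integral>\<^sup>+t. ennreal (1 / t) * indicator {T * exp (- L)..T} t \<partial>lborel)"
  proof (intro nn_integral_mono)
    fix t :: real
    have [measurable]: "{x. cdf M x \<le> t} \<in> sets M"
      by (intro sets_M) measurable
    have "(\<integral>\<^sup>+x. ?k x t \<partial>M) = ennreal (1 / t ^ 2) * indicator {T * exp (- L)..T} t * emeasure M {x. cdf M x \<le> t}"
      by (subst nn_integral_cmult_indicator) auto
    also have "\<dots> \<le> ennreal (1 / t ^ 2) * indicator {T * exp (- L)..T} t * ennreal t"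
    proof (cases "0 \<le> t")
      case True
      then show ?thesis
        using measure_cdf_le[of t] by (intro mult_left_mono) (auto simp: emeasure_eq_measure)
    qed (use T in \<open>auto simp: indicator_def\<close>)
    also have "\<dots> = ennreal (1 / t) * indicator {T * exp (- L)..T} t"
      using T by (auto simp: indicator_def power2_eq_square simp flip: ennreal_mult')
    finally show "(\<integral>\<^sup>+x. ?k x t \<partial>M) \<le> ennreal (1 / t) * indicator {T * exp (- L)..T} t" .
  qed
  also have "(\<integral>\<^sup>+t. ennreal (1 / t) * indicator {T * exp (- L)..T} t \<partial>lborel) = ennreal (ln T - ln (T * exp (- L)))"
    using T by (intro nn_integral_FTC_Icc) (auto intro!: DERIV_ln_divide)
  also have "ln T - ln (T * exp (- L)) = L"
    using T by (simp add: ln_mult)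
  also have "ennreal (1 / T) * emeasure M (space M) = 1"
    using T by (simp add: emeasure_eq_measure T_def flip: ennreal_mult)
  finally show ?thesis
    using assms by (simp add: add_left_mono)
qed

lemma nn_integral_profile_powr:
  assumes "0 \<le> L" "0 < r"
  shows "(\<integral>\<^sup>+x. ennreal (profile r L x powr r) \<partial>M) \<le> ennreal (1 + L)"
proof -
  have "profile r L x powr r = 1 / trunc_cdf L x" for x
    using assms(2) powr_minus_divide[of "trunc_cdf L x" 1] trunc_cdf_pos[of L x]
    by (simp only: profile_def powr_powr) (simp add: less_imp_le)
  then show ?thesis
    using nn_integral_inverse_trunc_cdf[OF assms(1)] by simp
qed

end

section \<open>Norms with respect to the multiplicative measure\<close>

lemma mult_norm_ge:
  assumes "0 < a" "a \<le> b" "0 < s" "s \<noteq> \<infinity>" "0 \<le> c"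
    and ge: "\<And>t. a \<le> t \<Longrightarrow> t < b \<Longrightarrow> ennreal c \<le> g t"
  shows "ennreal (c * ln (b / a) powr (1 / enn2real s)) \<le> mult_norm s g"
proof -
  define s' where "s' = enn2real s"
  have s': "0 < s'"
    using enn2real_pos[OF assms(3,4)] by (simp add: s'_def)
  have "ennreal (c powr s' * ln (b / a)) = ennreal (c powr s' * ln b - c powr s' * ln a)"
    using assms by (simp add: ln_div algebra_simps)
  also have "\<dots> = (\<integral>\<^sup>+t. ennreal (c powr s' / t) * indicator {a..b} t \<partial>lborel)"
    using assms by (intro nn_integral_FTC_Icc[symmetric]) (auto intro!: derivative_eq_intros)
  also have "\<dots> = (\<integral>\<^sup>+t. ennreal (c powr s' / t) * indicator {a..<b} t \<partial>lborel)"
    by (intro nn_integral_cong_AE eventually_mono[OF AE_lborel_singleton[of b]])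
       (auto simp: indicator_def)
  also have "\<dots> \<le> (\<integral>\<^sup>+t\<in>{0<..}. (ennreal_powr (g t) s' / ennreal t) \<partial>lborel)"
  proof (intro nn_integral_mono)
    fix t :: real
    show "ennreal (c powr s' / t) * indicator {a..<b} t \<le> ennreal_powr (g t) s' / ennreal t * indicator {0<..} t"
    proof (cases "t \<in> {a..<b}")
      case True
      then have "ennreal (c powr s') \<le> ennreal_powr (g t) s'"
        using ennreal_powr_mono[OF ge s', of t] assms(5) by simp
      then have "ennreal (c powr s') / ennreal t \<le> ennreal_powr (g t) s' / ennreal t"
        by (rule divide_right_mono_ennreal)
      with True assms show ?thesis
        by (simp add: divide_ennreal)
    qed simp
  qed
  finally have "ennreal_powr (ennreal (c powr s' * ln (b / a))) (1 / s') \<le> mult_norm s g"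
    unfolding mult_norm_def using assms(4) s' by (auto simp: s'_def intro!: ennreal_powr_mono)
  then show ?thesis
    using assms s' by (simp add: powr_mult powr_powr s'_def)
qed

lemma mult_norm_le:
  assumes "0 < q" "q \<noteq> \<infinity>" "0 \<le> K" "0 < B" "1 \<le> R * B"
    and le: "\<And>u. 0 < u \<Longrightarrow> g u \<le> ennreal (K * min 1 (B * u))"
    and eq_0: "\<And>u. R \<le> u \<Longrightarrow> g u = 0"
  shows "mult_norm q g \<le> ennreal (K * (1 / enn2real q + ln (R * B)) powr (1 / enn2real q))"
proof -
  define q' where "q' = enn2real q"
  have q': "0 < q'"
    using enn2real_pos[OF assms(1,2)] by (simp add: q'_def)
  have R: "0 < R" "1 / B \<le> R"
    using assms(4,5) zero_less_mult_pos2[of R B] by (auto simp: field_simps)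
  let ?low = "\<lambda>u. ennreal (u powr (q' - 1)) * indicator {0..1 / B} u"
  let ?high = "\<lambda>u. ennreal (1 / u) * indicator {1 / B..R} u"
  have "(\<integral>\<^sup>+u\<in>{0<..}. (ennreal_powr (g u) q' / ennreal u) \<partial>lborel) \<le>
      (\<integral>\<^sup>+u. ennreal ((K * B) powr q') * ?low u + ennreal (K powr q') * ?high u \<partial>lborel)"
  proof (intro nn_integral_mono)
    fix u :: real
    let ?rhs = "ennreal ((K * B) powr q') * ?low u + ennreal (K powr q') * ?high u"
    show "ennreal_powr (g u) q' / ennreal u * indicator {0<..} u \<le> ?rhs"
    proof (cases "0 < u \<and> u < R")
      case True
      have "ennreal_powr (g u) q' \<le> ennreal ((K * min 1 (B * u)) powr q')"
        using ennreal_powr_mono[OF le q', of u] True assms by simp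
      then have "ennreal_powr (g u) q' / ennreal u \<le> ennreal ((K * min 1 (B * u)) powr q' / u)"
        using True divide_right_mono_ennreal by (fastforce simp flip: divide_ennreal)
      also have "\<dots> \<le> ?rhs"
      proof (cases "u \<le> 1 / B")
        case below: True
        then have "min 1 (B * u) = B * u"
          using assms(4) by (simp add: field_simps)
        then have "(K * min 1 (B * u)) powr q' / u = (K * B) powr q' * u powr (q' - 1)"
          using True assms by (simp add: powr_mult powr_diff mult_ac)
        then show ?thesis
          using below True by (simp add: ennreal_mult add_increasing2)
      next
        case False
        then have "min 1 (B * u) = 1"
          using assms(4) by (simp add: field_simps)
        with False True show ?thesis
          by (simp flip: ennreal_mult')
      qed
      finally show ?thesis
        using True by simp
    next
      case False
      then show ?thesis
        using eq_0[of u] q' by (auto simp: ennreal_powr_def indicator_def)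
    qed
  qed
  also have "\<dots> = ennreal ((K * B) powr q') * (\<integral>\<^sup>+u. ?low u \<partial>lborel) +
      ennreal (K powr q') * (\<integral>\<^sup>+u. ?high u \<partial>lborel)"
    by (subst nn_integral_add, simp, simp) (subst (1 2) nn_integral_cmult, auto)
  also have "(\<integral>\<^sup>+u. ?low u \<partial>lborel) = ennreal ((1 / B) powr q' / q')"
    using has_integral_powr_from_0[of "q' - 1" "1 / B"] q' assms(4)
    by (subst nn_integral_has_integral_lebesgue') (auto simp: less_imp_le)
  also have "(\<integral>\<^sup>+u. ?high u \<partial>lborel) = ennreal (ln R - ln (1 / B))"
  proof (rule nn_integral_FTC_Icc)
    fix u assume "u \<in> {1 / B..R}"
    then have "0 < u"
      using assms(4) less_le_trans[of 0 "1 / B" u] by simp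
    then show "(ln has_real_derivative 1 / u) (at u)" "0 \<le> 1 / u"
      by (auto intro!: DERIV_ln_divide)
  qed (use R in auto)
  also have "ln R - ln (1 / B) = ln (R * B)"
    using R assms(4) by (simp add: ln_mult ln_div)
  also have "ennreal ((K * B) powr q') * ennreal ((1 / B) powr q' / q') + ennreal (K powr q') * ennreal (ln (R * B)) =
      ennreal (K powr q' * (1 / q' + ln (R * B)))"
    using assms q' by (simp add: powr_mult powr_divide distrib_left flip: ennreal_mult ennreal_plus)
  finally have "mult_norm q g \<le> ennreal_powr (ennreal (K powr q' * (1 / q' + ln (R * B)))) (1 / q')"
    unfolding mult_norm_def using assms(2) q' by (auto simp: q'_def intro!: ennreal_powr_mono)
  also have "\<dots> = ennreal (K * (1 / q' + ln (R * B)) powr (1 / q'))"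
    using assms q' by (simp add: powr_mult powr_powr)
  finally show ?thesis
    by (simp add: q'_def)
qed

section \<open>Growth of the norms of the test functions\<close>

lemma not_cont_embedded_growth:
  assumes "\<And>L. 1 \<le> L \<Longrightarrow> f L \<in> borel_measurable M"
    and upper: "\<And>L. 1 \<le> L \<Longrightarrow> N\<^sub>1 (f L) \<le> ennreal (K * L powr a)"
    and lower: "\<And>L. 1 \<le> L \<Longrightarrow> ennreal (\<kappa> * L powr b) \<le> N\<^sub>2 (f L)"
    and "a < b" "0 < \<kappa>" "0 \<le> K"
  shows "\<not> cont_embedded M N\<^sub>1 N\<^sub>2"
proof
  assume "cont_embedded M N\<^sub>1 N\<^sub>2"
  then obtain c where "0 < c"
    and c: "\<And>h. h \<in> function_space M N\<^sub>1 \<Longrightarrow> N\<^sub>2 h \<le> ennreal c * N\<^sub>1 h"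
    by (auto simp: cont_embedded_def)
  have bound: "\<kappa> * L powr (b - a) \<le> c * K" if "1 \<le> L" for L
  proof -
    have "f L \<in> function_space M N\<^sub>1"
      using assms(1)[OF that] le_less_trans[OF upper[OF that] ennreal_less_top]
      by (simp add: function_space_def)
    then have "ennreal (\<kappa> * L powr b) \<le> ennreal c * N\<^sub>1 (f L)"
      using lower[OF that] c by (blast intro: order_trans)
    also have "\<dots> \<le> ennreal (c * (K * L powr a))"
      using upper[OF that] \<open>0 < c\<close> by (simp add: ennreal_mult' mult_left_mono)
    finally have "\<kappa> * L powr b \<le> c * (K * L powr a)"
      using \<open>0 < c\<close> \<open>0 \<le> K\<close> by (subst (asm) ennreal_le_iff) auto
    with that show ?thesis
      by (simp add: powr_diff field_simps)
  qed
  define L where "L = (c * K / \<kappa> + 1) powr (1 / (b - a))"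
  have "0 \<le> c * K / \<kappa>"
    using \<open>0 < c\<close> assms(5,6) by simp
  then have "1 \<le> L"
    using assms(4) by (auto simp: L_def intro!: ge_one_powr_ge_zero)
  have "L powr (b - a) = c * K / \<kappa> + 1"
    using \<open>0 \<le> c * K / \<kappa>\<close> assms(4) by (simp add: L_def powr_powr)
  then show False
    using bound[OF \<open>1 \<le> L\<close>] assms(5) by (simp add: field_simps)
qed

locale finite_box =
  fixes \<Omega> :: "'n::{finite,linorder} \<Rightarrow> real set" and p :: "'n \<Rightarrow> ennreal" and k :: 'n
  assumes lebesgue: "\<And>i. \<Omega> i \<in> sets lebesgue"
    and pos: "\<And>i. 0 < emeasure lebesgue (\<Omega> i)"
    and finite: "\<And>i. emeasure lebesgue (\<Omega> i) < \<infinity>"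
    and p_pos: "\<And>i. 0 < p i"
    and p_finite: "p k \<noteq> \<infinity>"
begin

definition N :: "real measure" where
  "N = distr (lebesgue_on (\<Omega> k)) borel (\<lambda>x. x)"

definition r :: real where
  "r = enn2real (p k)"

definition Q :: real where
  "Q = (\<Prod>i\<in>UNIV - {k}. measure lebesgue (\<Omega> i))"

lemma r_pos: "0 < r"
  using enn2real_pos[OF p_pos p_finite] by (simp add: r_def)

lemma Q_pos: "0 < Q"
  unfolding Q_def using pos finite by (intro prod_pos) (auto simp: measure_def enn2real_positive_iff)

lemma measurable_id [measurable]: "(\<lambda>x. x) \<in> lebesgue_on (\<Omega> k) \<rightarrow>\<^sub>M borel"
  by (intro measurable_restrict_space1 measurable_completion) simp

lemma emeasure_N: "X \<in> sets borel \<Longrightarrow> emeasure N X = emeasure lebesgue (\<Omega> k \<inter> X)"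
  unfolding N_def using lebesgue[of k]
  by (subst emeasure_distr) (auto simp: space_restrict_space emeasure_restrict_space Int_commute)

sublocale N: atomless_borel_measure N
proof (intro atomless_borel_measure.intro finite_borel_measure.intro finite_measureI
    finite_borel_measure_axioms.intro atomless_borel_measure_axioms.intro)
  show "emeasure N (space N) \<noteq> \<infinity>"
    using emeasure_N[of UNIV] finite[of k] by (simp add: N_def)
  show "sets N = sets borel"
    by (simp add: N_def)
  show "measure N {x} = 0" for x
  proof -
    have "emeasure lebesgue (\<Omega> k \<inter> {x}) \<le> emeasure lebesgue {x}"
      by (intro emeasure_mono) auto
    then show ?thesis
      by (simp add: measure_def emeasure_N)
  qed
  show "0 < measure N (space N)"
    using emeasure_N[of UNIV] finite[of k] pos[of k] by (simp add: N_def measure_def enn2real_positive_iff)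
qed

definition test_fun :: "real \<Rightarrow> real ^ 'n::{finite,linorder} \<Rightarrow> real" where
  "test_fun L x = N.profile r L (x $ k)"

lemma borel_measurable_test_fun: "test_fun L \<in> borel_measurable (lebesgue_on (box_product \<Omega>))"
proof -
  have "test_fun L \<in> borel_measurable borel"
    unfolding test_fun_def[abs_def] by measurable
  then show ?thesis
    by (intro measurable_restrict_space1 measurable_completion) simp
qed

lemma emeasure_box_slice:
  assumes "X \<in> sets borel"
  shows "emeasure (lebesgue_on (box_product \<Omega>)) {x \<in> space (lebesgue_on (box_product \<Omega>)). x $ k \<in> X} =
    ennreal Q * emeasure N X"
proof -
  let ?S = "\<lambda>i. if i = k then \<Omega> k \<inter> X else \<Omega> i"
  have sets: "?S i \<in> sets lebesgue" for i
    using lebesgue assms by auto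
  have fin: "emeasure lebesgue (\<Omega> i) = ennreal (measure lebesgue (\<Omega> i))" for i
    using finite[of i] by (intro emeasure_eq_ennreal_measure) auto
  have "{x \<in> space (lebesgue_on (box_product \<Omega>)). x $ k \<in> X} = box_product ?S"
    by (auto simp: space_restrict_space box_product_def split: if_splits)
  moreover have "box_product ?S \<subseteq> box_product \<Omega>"
    by (auto simp: box_product_def split: if_splits)
  ultimately have "emeasure (lebesgue_on (box_product \<Omega>)) {x \<in> space (lebesgue_on (box_product \<Omega>)). x $ k \<in> X} =
      emeasure lebesgue (box_product ?S)"
    using box_product_lebesgue[of \<Omega>, OF lebesgue] by (simp add: emeasure_restrict_space)
  also have "\<dots> = (\<Prod>i\<in>UNIV. emeasure lebesgue (?S i))"
    using sets by (rule emeasure_box_product)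
  also have "\<dots> = emeasure lebesgue (\<Omega> k \<inter> X) * (\<Prod>i\<in>UNIV - {k}. emeasure lebesgue (\<Omega> i))"
    by (subst prod.remove[of _ k]) auto
  also have "\<dots> = ennreal Q * emeasure N X"
  proof -
    have "(\<Prod>i\<in>UNIV - {k}. emeasure lebesgue (\<Omega> i)) = ennreal Q"
      unfolding fin Q_def by (rule prod_ennreal) simp
    then show ?thesis
      by (simp add: emeasure_N[OF assms] mult.commute)
  qed
  finally show ?thesis .
qed

lemma mixed_norm_coordinate:
  obtains C where "0 \<le> C"
    and "\<And>h. h \<in> borel_measurable borel \<Longrightarrow> mixed_norm \<Omega> p (\<lambda>x. h (x $ k)) =
      ennreal C * ennreal_powr (\<integral>\<^sup>+t. ennreal (\<bar>h t\<bar> powr r) \<partial>N) (1 / r)"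
proof -
  obtain C where C: "C < \<infinity>" "\<And>h. h \<in> borel_measurable borel \<Longrightarrow>
      mixed_norm \<Omega> p (\<lambda>x. h (x $ k)) = C * Lp_norm (lebesgue_on (\<Omega> k)) (p k) (\<lambda>t. ennreal \<bar>h t\<bar>)"
    using mixed_norm_one_coordinate[of \<Omega> p k, OF lebesgue pos finite p_pos p_finite] by metis
  show thesis
  proof
    show "0 \<le> enn2real C" by simp
    fix h :: "real \<Rightarrow> real" assume [measurable]: "h \<in> borel_measurable borel"
    have "(\<integral>\<^sup>+t. ennreal (\<bar>h t\<bar> powr r) \<partial>N) = (\<integral>\<^sup>+t. ennreal (\<bar>h t\<bar> powr r) \<partial>lebesgue_on (\<Omega> k))"
      unfolding N_def by (subst nn_integral_distr) auto
    then show "mixed_norm \<Omega> p (\<lambda>x. h (x $ k)) =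
        ennreal (enn2real C) * ennreal_powr (\<integral>\<^sup>+t. ennreal (\<bar>h t\<bar> powr r) \<partial>N) (1 / r)"
      using C p_finite by (simp add: Lp_norm_def r_def)
  qed
qed

lemma mixed_norm_test_fun:
  obtains K where "0 \<le> K" "\<And>L. 1 \<le> L \<Longrightarrow> mixed_norm \<Omega> p (test_fun L) \<le> ennreal (K * L powr (1 / r))"
proof -
  obtain C where "0 \<le> C" and C: "\<And>h. h \<in> borel_measurable borel \<Longrightarrow> mixed_norm \<Omega> p (\<lambda>x. h (x $ k)) =
      ennreal C * ennreal_powr (\<integral>\<^sup>+t. ennreal (\<bar>h t\<bar> powr r) \<partial>N) (1 / r)"
    by (rule mixed_norm_coordinate) blast
  show thesis
  proof
    show "0 \<le> C * 2 powr (1 / r)"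
      using \<open>0 \<le> C\<close> by simp
    fix L :: real assume "1 \<le> L"
    have "(\<integral>\<^sup>+t. ennreal (\<bar>N.profile r L t\<bar> powr r) \<partial>N) \<le> ennreal (1 + L)"
      using N.nn_integral_profile_powr[of L r] r_pos \<open>1 \<le> L\<close> by simp
    also have "\<dots> \<le> ennreal (2 * L)"
      using \<open>1 \<le> L\<close> by (intro ennreal_leI) simp
    finally have "mixed_norm \<Omega> p (test_fun L) \<le> ennreal C * ennreal_powr (ennreal (2 * L)) (1 / r)"
      unfolding test_fun_def[abs_def] using r_pos
      by (subst C) (auto intro!: mult_left_mono ennreal_powr_mono)
    then show "mixed_norm \<Omega> p (test_fun L) \<le> ennreal (C * 2 powr (1 / r) * L powr (1 / r))"
      using \<open>0 \<le> C\<close> \<open>1 \<le> L\<close> ennreal_powr_ennreal[of "2 * L" "1 / r"]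
      by (simp add: powr_mult ennreal_mult mult.assoc)
  qed
qed

lemma mixed_norm_level_set:
  obtains C B where "0 \<le> C" "0 < B"
    and "\<And>L u. 0 < u \<Longrightarrow> ennreal u * mixed_norm \<Omega> p (indicator {x. \<bar>test_fun L x\<bar> > u}) \<le>
      ennreal (C * min 1 (B * u))"
    and "\<And>L u. exp (L / r) / B \<le> u \<Longrightarrow> mixed_norm \<Omega> p (indicator {x. \<bar>test_fun L x\<bar> > u}) = 0"
proof -
  define T where "T = measure N (space N)"
  have "0 < T"
    using N.total_pos by (simp add: T_def)
  obtain C where "0 \<le> C" and C: "\<And>h. h \<in> borel_measurable borel \<Longrightarrow> mixed_norm \<Omega> p (\<lambda>x. h (x $ k)) =
      ennreal C * ennreal_powr (\<integral>\<^sup>+t. ennreal (\<bar>h t\<bar> powr r) \<partial>N) (1 / r)"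
    by (rule mixed_norm_coordinate) blast
  have level: "mixed_norm \<Omega> p (indicator {x. \<bar>test_fun L x\<bar> > u}) =
      ennreal C * ennreal_powr (emeasure N {t. u < N.profile r L t}) (1 / r)" for L u
  proof -
    have "indicator {x. \<bar>test_fun L x\<bar> > u} =
        (\<lambda>x. indicator {t. u < N.profile r L t} (x $ k) :: real)"
      by (auto simp: indicator_def test_fun_def)
    moreover have "(\<integral>\<^sup>+t. ennreal (\<bar>indicator {t. u < N.profile r L t} t\<bar> powr r) \<partial>N) =
        (\<integral>\<^sup>+t. indicator {t. u < N.profile r L t} t \<partial>N)"
      using r_pos by (intro nn_integral_cong) (auto simp: indicator_def)
    moreover have "{t. u < N.profile r L t} \<in> sets N"
      by (intro N.sets_M) measurable
    moreover have "(indicator {t. u < N.profile r L t} :: real \<Rightarrow> real) \<in> borel_measurable borel"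
      by measurable
    ultimately show ?thesis
      by (simp add: C)
  qed
  show thesis
  proof
    show "0 \<le> C" by fact
    show "0 < T powr (1 / r)"
      using \<open>0 < T\<close> by simp
    fix L u :: real
    {
      assume "0 < u"
      have "(u powr (- r)) powr (1 / r) = 1 / u"
        using r_pos \<open>0 < u\<close> by (simp only: powr_powr) (simp add: powr_minus_divide)
      then have "ennreal_powr (emeasure N {t. u < N.profile r L t}) (1 / r) \<le> ennreal (1 / u)"
        using ennreal_powr_mono[OF N.emeasure_profile_le[OF r_pos \<open>0 < u\<close>, of L], of "1 / r"] r_pos
        by (simp del: powr_minus_divide)
      moreover have "ennreal_powr (emeasure N {t. u < N.profile r L t}) (1 / r) \<le> ennreal (T powr (1 / r))"
        using ennreal_powr_mono[of "emeasure N {t. u < N.profile r L t}" "ennreal T" "1 / r"] r_pos \<open>0 < T\<close>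
          N.bounded_measure[of "{t. u < N.profile r L t}"]
        by (simp add: N.emeasure_eq_measure T_def)
      ultimately have "ennreal_powr (emeasure N {t. u < N.profile r L t}) (1 / r) \<le> ennreal (min (1 / u) (T powr (1 / r)))"
        by (simp add: min_def)
      then have "ennreal u * (ennreal C * ennreal_powr (emeasure N {t. u < N.profile r L t}) (1 / r)) \<le>
          ennreal u * (ennreal C * ennreal (min (1 / u) (T powr (1 / r))))"
        by (intro mult_left_mono) auto
      also have "\<dots> = ennreal (C * (u * min (1 / u) (T powr (1 / r))))"
        using \<open>0 \<le> C\<close> \<open>0 < u\<close> by (simp add: mult_ac flip: ennreal_mult)
      also have "u * min (1 / u) (T powr (1 / r)) = min 1 (T powr (1 / r) * u)"
        using \<open>0 < u\<close> by (simp add: min_mult_distrib_left mult.commute)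
      finally show "ennreal u * mixed_norm \<Omega> p (indicator {x. \<bar>test_fun L x\<bar> > u}) \<le>
          ennreal (C * min 1 (T powr (1 / r) * u))"
        by (simp add: level)
    }
    {
      assume "exp (L / r) / T powr (1 / r) \<le> u"
      also have "exp (L / r) / T powr (1 / r) = (T * exp (- L)) powr (- 1 / r)"
        using \<open>0 < T\<close> by (simp add: powr_def exp_diff ln_mult algebra_simps diff_divide_distrib flip: exp_minus)
      finally show "mixed_norm \<Omega> p (indicator {x. \<bar>test_fun L x\<bar> > u}) = 0"
        using N.emeasure_profile_eq_0[OF r_pos, of L u] by (simp add: level T_def ennreal_powr_def)
    }
  qed
qed

lemma mixed_Lorentz_norm_test_fun:
  assumes "0 < q"
  obtains K where "0 \<le> K"
    and "\<And>L. 1 \<le> L \<Longrightarrow> mixed_Lorentz_norm \<Omega> p q (test_fun L) \<le>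
      ennreal (K * L powr (if q = \<infinity> then 0 else 1 / enn2real q))"
proof -
  obtain C B where "0 \<le> C" "0 < B"
    and le: "\<And>L u. 0 < u \<Longrightarrow> ennreal u * mixed_norm \<Omega> p (indicator {x. \<bar>test_fun L x\<bar> > u}) \<le>
      ennreal (C * min 1 (B * u))"
    and eq_0: "\<And>L u. exp (L / r) / B \<le> u \<Longrightarrow> mixed_norm \<Omega> p (indicator {x. \<bar>test_fun L x\<bar> > u}) = 0"
    by (rule mixed_norm_level_set) blast
  show thesis
  proof (cases "q = \<infinity>")
    case True
    show thesis
    proof
      show "0 \<le> C" by fact
      fix L :: real assume "1 \<le> L"
      have "ennreal u * mixed_norm \<Omega> p (indicator {x. \<bar>test_fun L x\<bar> > u}) \<le> ennreal C" if "0 < u" for u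
      proof -
        have "C * min 1 (B * u) \<le> C * 1"
          using \<open>0 \<le> C\<close> by (intro mult_left_mono) auto
        then show ?thesis
          using le[OF that, of L] by (auto intro: order_trans ennreal_leI)
      qed
      then show "mixed_Lorentz_norm \<Omega> p q (test_fun L) \<le>
          ennreal (C * L powr (if q = \<infinity> then 0 else 1 / enn2real q))"
        using True \<open>1 \<le> L\<close> by (auto simp: mixed_Lorentz_norm_def mult_norm_def intro!: SUP_least)
    qed
  next
    case False
    define q' where "q' = enn2real q"
    have "0 < q'"
      using enn2real_pos[OF assms False] by (simp add: q'_def)
    show thesis
    proof
      show "0 \<le> C * (1 / q' + 1 / r) powr (1 / q')"
        using \<open>0 \<le> C\<close> by simp
      fix L :: real assume "1 \<le> L"
      have "mixed_Lorentz_norm \<Omega> p q (test_fun L) \<le>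
          ennreal (C * (1 / q' + ln (exp (L / r) / B * B)) powr (1 / q'))"
        unfolding mixed_Lorentz_norm_def q'_def
        using assms False \<open>0 \<le> C\<close> \<open>0 < B\<close> \<open>1 \<le> L\<close> r_pos le eq_0 by (intro mult_norm_le) auto
      also have "ln (exp (L / r) / B * B) = L / r"
        using \<open>0 < B\<close> by simp
      also have "(1 / q' + L / r) powr (1 / q') \<le> ((1 / q' + 1 / r) * L) powr (1 / q')"
        using \<open>0 < q'\<close> \<open>1 \<le> L\<close> r_pos by (intro powr_mono2) (auto simp: field_simps)
      also have "((1 / q' + 1 / r) * L) powr (1 / q') = (1 / q' + 1 / r) powr (1 / q') * L powr (1 / q')"
        using \<open>0 < q'\<close> \<open>1 \<le> L\<close> r_pos by (simp add: powr_mult)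
      finally show "mixed_Lorentz_norm \<Omega> p q (test_fun L) \<le>
          ennreal (C * (1 / q' + 1 / r) powr (1 / q') * L powr (if q = \<infinity> then 0 else 1 / enn2real q))"
        using False \<open>0 \<le> C\<close> by (simp add: q'_def mult.assoc ennreal_leI mult_left_mono)
    qed
  qed
qed

lemma decr_rearrangement_test_fun:
  assumes t: "Q * (measure N (space N) * exp (- L)) \<le> t" "t < Q * measure N (space N)"
  shows "ennreal ((t / Q) powr (- 1 / r)) \<le> decr_rearrangement (lebesgue_on (box_product \<Omega>)) (test_fun L) t"
  unfolding decr_rearrangement_def
proof (intro Inf_greatest, clarify)
  fix \<sigma> :: real
  assume \<sigma>: "0 < \<sigma>" "emeasure (lebesgue_on (box_product \<Omega>))
      {x \<in> space (lebesgue_on (box_product \<Omega>)). \<sigma> < \<bar>test_fun L x\<bar>} \<le> ennreal t"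
  have "0 \<le> t"
    using t(1) Q_pos N.total_pos by (intro order_trans[OF _ t(1)]) auto
  show "ennreal ((t / Q) powr (- 1 / r)) \<le> ennreal \<sigma>"
  proof (rule ccontr)
    assume "\<not> ?thesis"
    then have "\<sigma> < (t / Q) powr (- 1 / r)"
      using \<sigma>(1) by (auto simp: not_le ennreal_less_iff)
    then have "ennreal (t / Q) < emeasure N {x. \<sigma> < N.profile r L x}"
      using r_pos \<sigma>(1) t Q_pos by (intro N.emeasure_profile_greater) (auto simp: field_simps)
    then have "ennreal Q * ennreal (t / Q) < ennreal Q * emeasure N {x. \<sigma> < N.profile r L x}"
      using Q_pos \<open>0 \<le> t\<close> by (intro ennreal_mult_strict_left_mono) auto
    also have "\<dots> = emeasure (lebesgue_on (box_product \<Omega>))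
      {x \<in> space (lebesgue_on (box_product \<Omega>)). x $ k \<in> {x. \<sigma> < N.profile r L x}}"
      by (subst emeasure_box_slice) auto
    also have "\<dots> \<le> ennreal t"
      using \<sigma>(2) by (simp add: test_fun_def)
    finally show False
      using Q_pos \<open>0 \<le> t\<close> by (simp flip: ennreal_mult)
  qed
qed

lemma Lorentz_norm_test_fun:
  assumes "0 < s" "s \<noteq> \<infinity>" "1 \<le> L"
  shows "ennreal (Q powr (1 / r) * L powr (1 / enn2real s)) \<le>
    Lorentz_norm (lebesgue_on (box_product \<Omega>)) (p k) s (test_fun L)"
proof -
  define T where "T = measure N (space N)"
  have "0 < T"
    using N.total_pos by (simp add: T_def)
  have "Q * T / (Q * (T * exp (- L))) = exp L"
    using Q_pos \<open>0 < T\<close> by (simp add: exp_minus field_simps)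
  then have "ennreal (Q powr (1 / r) * L powr (1 / enn2real s)) =
      ennreal (Q powr (1 / r) * ln (Q * T / (Q * (T * exp (- L)))) powr (1 / enn2real s))"
    by simp
  also have "\<dots> \<le> Lorentz_norm (lebesgue_on (box_product \<Omega>)) (p k) s (test_fun L)"
    unfolding Lorentz_norm_def r_def[symmetric]
  proof (rule mult_norm_ge)
    fix t assume t: "Q * (T * exp (- L)) \<le> t" "t < Q * T"
    have "0 < t"
      using Q_pos \<open>0 < T\<close> by (intro less_le_trans[OF _ t(1)]) auto
    then have "ennreal (Q powr (1 / r)) = ennreal (t powr (1 / r)) * ennreal ((t / Q) powr (- 1 / r))"
      using Q_pos by (simp add: powr_divide powr_minus_divide flip: ennreal_mult)
    also have "\<dots> \<le> ennreal (t powr (1 / r)) *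
        decr_rearrangement (lebesgue_on (box_product \<Omega>)) (test_fun L) t"
      using t by (intro mult_left_mono decr_rearrangement_test_fun) (auto simp: T_def)
    finally show "ennreal (Q powr (1 / r)) \<le> ennreal (t powr (1 / r)) *
        decr_rearrangement (lebesgue_on (box_product \<Omega>)) (test_fun L) t" .
  qed (use assms Q_pos \<open>0 < T\<close> in auto)
  finally show ?thesis .
qed

lemma not_cont_embedded_mixed_norm:
  assumes "0 < s" "s < p k"
  shows "\<not> cont_embedded (lebesgue_on (box_product \<Omega>)) (mixed_norm \<Omega> p)
    (Lorentz_norm (lebesgue_on (box_product \<Omega>)) (p k) s)"
proof -
  have s: "s \<noteq> \<infinity>" "0 < enn2real s" "enn2real s < r"
    using assms p_finite by (auto simp: r_def enn2real_positive_iff enn2real_less_iff less_top)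
  obtain K where "0 \<le> K" "\<And>L. 1 \<le> L \<Longrightarrow> mixed_norm \<Omega> p (test_fun L) \<le> ennreal (K * L powr (1 / r))"
    by (rule mixed_norm_test_fun) blast
  then show ?thesis
    using s Q_pos borel_measurable_test_fun Lorentz_norm_test_fun[OF assms(1) s(1)]
    by (intro not_cont_embedded_growth[where f = test_fun and \<kappa> = "Q powr (1 / r)" and b = "1 / enn2real s"])
       (auto simp: frac_less2)
qed

lemma not_cont_embedded_mixed_Lorentz_norm:
  assumes "0 < u" "u < q"
  shows "\<not> cont_embedded (lebesgue_on (box_product \<Omega>)) (mixed_Lorentz_norm \<Omega> p q)
    (Lorentz_norm (lebesgue_on (box_product \<Omega>)) (p k) u)"
proof -
  have u: "u \<noteq> \<infinity>" "0 < enn2real u"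
    using assms less_le_trans[OF assms(2) top_greatest] by (auto simp: enn2real_positive_iff)
  have "(if q = \<infinity> then 0 else 1 / enn2real q) < 1 / enn2real u"
  proof (cases "q = \<infinity>")
    case False
    then have "enn2real u < enn2real q"
      using assms by (cases u; cases q) (auto simp: ennreal_less_iff)
    with False u show ?thesis
      by (simp add: frac_less2)
  qed (use u in simp)
  moreover obtain K where "0 \<le> K" "\<And>L. 1 \<le> L \<Longrightarrow> mixed_Lorentz_norm \<Omega> p q (test_fun L) \<le>
      ennreal (K * L powr (if q = \<infinity> then 0 else 1 / enn2real q))"
    by (rule mixed_Lorentz_norm_test_fun[OF order.strict_trans[OF assms]]) blast
  ultimately show ?thesis
    using u Q_pos borel_measurable_test_fun Lorentz_norm_test_fun[OF assms(1) u(1)]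
    by (intro not_cont_embedded_growth[where f = test_fun and \<kappa> = "Q powr (1 / r)" and b = "1 / enn2real u"]) auto
qed

end

theorem corollary7p6:
  fixes \<Omega> :: "'n::{finite,linorder} \<Rightarrow> real set"
    and p :: "'n \<Rightarrow> ennreal"
    and q :: ennreal
  assumes "\<And>i. \<Omega> i \<in> sets lebesgue"
    and "\<And>i. emeasure lebesgue (\<Omega> i) > 0"
    and "\<And>i. 0 < p i"
    and "Min (range p) < \<infinity>"
    and "0 < q"
    and "emeasure lebesgue (box_product \<Omega>) < \<infinity>"
  shows "(\<forall>s. 0 < s \<and> s < Min (range p) \<longrightarrow>
            \<not> cont_embedded (lebesgue_on (box_product \<Omega>))
                (mixed_norm \<Omega> p)
                (Lorentz_norm (lebesgue_on (box_product \<Omega>)) (Min (range p)) s)) \<and>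
         (\<forall>u. 0 < u \<and> u < q \<longrightarrow>
            \<not> cont_embedded (lebesgue_on (box_product \<Omega>))
                (mixed_Lorentz_norm \<Omega> p q)
                (Lorentz_norm (lebesgue_on (box_product \<Omega>)) (Min (range p)) u))"
proof -
  have "Min (range p) \<in> range p"
    by (intro Min_in) auto
  then obtain k where k: "Min (range p) = p k"
    by blast
  have "emeasure lebesgue (\<Omega> i) < \<infinity>" for i
  proof (rule ccontr)
    assume "\<not> ?thesis"
    then have "emeasure lebesgue (\<Omega> i) = \<infinity>"
      by (simp add: not_less top_unique)
    moreover have "(\<Prod>j\<in>UNIV - {i}. emeasure lebesgue (\<Omega> j)) \<noteq> 0"
      using assms(2) by (auto simp: zero_less_iff_neq_zero)
    ultimately have "emeasure lebesgue (box_product \<Omega>) = \<infinity>"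
      unfolding emeasure_box_product[of \<Omega>, OF assms(1)]
      by (subst prod.remove[of _ i]) (auto simp: ennreal_top_mult)
    with assms(6) show False by simp
  qed
  then interpret finite_box \<Omega> p k
    using assms k by unfold_locales auto
  show ?thesis
    unfolding k using not_cont_embedded_mixed_norm not_cont_embedded_mixed_Lorentz_norm by blast
qed

end
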